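(* Let $0<p\le1$ and $\zeta\in\mathbb{H}$. The unit tangent circle $\{v\in T_\zeta\mathbb{H}\cong\mathbb{C}:\|v\|_{\delta_p}=1\}$ with respect to the weak norm $\|\cdot\|_{\delta_p}$ is an ellipse with foci $0$ and $$-\,i\,\frac{4\,\mathrm{Im}(\zeta)(1-p)}{p(2-p)} .$$
   Context: $\mathbb{H}=\{z\in\mathbb{C}\mid \mathrm{Im}(z)>0\}$, and each tangent space $T_\zeta\mathbb{H}$ is identified with $\mathbb{C}$ as a real vector space. For $0\le p\le1$ the weak metric $\delta_p$ on $\mathbb{H}$ is $$\delta_p(\zeta_1,\zeta_2)=\log\sup_{x\in\mathbb{R}}\frac{(\mathrm{Im}\,\zeta_1)^{p/2}}{(\mathrm{Im}\,\zeta_2)^{p/2}}\left|\frac{\zeta_2-x}{\zeta_1-x}\right| ,$$ and its infinitesimal weak norm at $\zeta$ is $$\|v\|_{\delta_p}=\lim_{t\to0^+}\frac{\delta_p(\zeta,\zeta+tv)}{t}=\frac{|v|+(1-p)\,\mathrm{Im}(v)}{2\,\mathrm{Im}(\zeta)} .$$ A circle is regarded as an ellipse whose two foci coincide (case $p=1$). *)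

theory Defs
  imports "HOL-Analysis.Analysis"
begin

definition upper_half_plane :: "complex set" where
  "upper_half_plane = {z. 0 < Im z}"

text \<open>On the upper half plane the set over which the supremum is taken is nonempty and bounded
  above, so the real-valued \<open>SUP\<close> is the actual supremum.\<close>

definition weak_metric :: "real \<Rightarrow> complex \<Rightarrow> complex \<Rightarrow> real" where
  "weak_metric p \<zeta>1 \<zeta>2 =
     ln (SUP x::real. (Im \<zeta>1) powr (p / 2) / (Im \<zeta>2) powr (p / 2)
                        * cmod ((\<zeta>2 - of_real x) / (\<zeta>1 - of_real x)))"

text \<open>The tangent space at \<open>\<zeta>\<close> is identified with the type of complex numbers. For small positive
  \<open>t\<close> the point \<open>\<zeta> + t v\<close> stays in the upper half plane, so the one-sided limit at 0 only involves
  values of the weak metric at points of the upper half plane.\<close>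

definition weak_norm :: "real \<Rightarrow> complex \<Rightarrow> complex \<Rightarrow> real" where
  "weak_norm p \<zeta> v = Lim (at_right 0) (\<lambda>t. weak_metric p \<zeta> (\<zeta> + t *\<^sub>R v) / t)"

definition unit_tangent_circle :: "real \<Rightarrow> complex \<Rightarrow> complex set" where
  "unit_tangent_circle p \<zeta> = {v. weak_norm p \<zeta> v = 1}"

text \<open>The strict inequality excludes segments, single points and the empty set. The two foci
  may coincide, in which case the ellipse is a circle of positive radius.\<close>

definition ellipse_with_foci :: "complex set \<Rightarrow> complex \<Rightarrow> complex \<Rightarrow> bool" where
  "ellipse_with_foci E f1 f2 \<longleftrightarrow>
     (\<exists>c. dist f1 f2 < c \<and> E = {z. dist z f1 + dist z f2 = c})"

end

theory Submission
  imports Defs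
begin

text \<open>
  As \<open>x\<close> runs through the reals, \<open>1 / (\<zeta>1 - x)\<close> runs through the circle with centre
  \<open>- \<i> / (2 Im \<zeta>1)\<close> and radius \<open>1 / (2 Im \<zeta>1)\<close>, with the point 0 removed. Since
  \<open>(\<zeta>2 - x) / (\<zeta>1 - x) = 1 + (\<zeta>2 - \<zeta>1) / (\<zeta>1 - x)\<close>, the supremum in the weak metric is
  \<open>(\<bar>\<zeta>2 - cnj \<zeta>1\<bar> + \<bar>\<zeta>2 - \<zeta>1\<bar>) / (2 Im \<zeta>1)\<close>, and differentiating its logarithm gives the weak
  norm. With \<open>q = 1 - p\<close> and \<open>c = 4 Im \<zeta> / (1 - q\<^sup>2)\<close>, squaring \<open>\<bar>v - f\<bar> = c - \<bar>v\<bar>\<close> for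
  \<open>f = - \<i> q c\<close> turns it into \<open>\<bar>v\<bar> + q Im v = 2 Im \<zeta>\<close>.
\<close>

text \<open>Rotating \<open>b\<close> into the direction of \<open>a\<close> gives equality in the
  triangle inequality. This locates the point where the supremum is reached or approached.\<close>

lemma exists_aligning_unit:
  fixes a b :: complex
  shows "\<exists>u. cmod u = 1 \<and> cmod (a + b * u) = cmod a + cmod b"
proof (cases "a = 0 \<or> b = 0")
  case True
  then show ?thesis by (intro exI[of _ 1]) auto
next
  case False
  define u where "u = sgn a * cnj (sgn b)"
  have "b * cnj (sgn b) = of_real (cmod b)"
    using False by (simp add: sgn_eq complex_norm_square[symmetric] power2_eq_square)
  then have "a + b * u = sgn a * of_real (cmod a + cmod b)"
    using False by (simp add: u_def sgn_eq field_simps)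
  then have "cmod (a + b * u) = cmod a + cmod b"
    using False by (simp add: norm_mult norm_sgn del: of_real_add)
  moreover have "cmod u = 1"
    using False by (simp add: u_def norm_mult norm_sgn)
  ultimately show ?thesis by blast
qed

text \<open>With \<open>w = z - x\<close> the sum equals
  \<open>\<i> * cnj w / (2 * Im z * w)\<close>, and \<open>w\<close> and \<open>cnj w\<close> have
  the same modulus.\<close>

lemma cmod_inverse_real_shift:
  assumes "0 < Im z"
  shows "cmod (1 / (z - of_real x) + \<i> / of_real (2 * Im z)) = 1 / (2 * Im z)"
proof -
  have nz: "z - of_real x \<noteq> 0" using assms by (auto simp: complex_eq_iff)
  have "1 / (z - of_real x) + \<i> / of_real (2 * Im z)
      = \<i> * cnj (z - of_real x) / (of_real (2 * Im z) * (z - of_real x))"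
    using assms nz by (simp add: field_simps) (simp add: complex_eq_iff)
  also have "cmod \<dots> = 1 / (2 * Im z)"
    using assms nz by (simp add: norm_mult norm_divide del: complex_cnj_diff)
  finally show ?thesis .
qed

text \<open>Expanding the circle equation gives \<open>Im (1 / w) = Im z\<close>, so
  \<open>z - 1 / w\<close> is real and serves as \<open>x\<close>.\<close>

lemma inverse_real_shift_surj:
  assumes "0 < Im z" "w \<noteq> 0" "cmod (w + \<i> / of_real (2 * Im z)) = 1 / (2 * Im z)"
  shows "\<exists>x::real. w = 1 / (z - of_real x)"
proof -
  have "(cmod (w + \<i> / of_real (2 * Im z)))\<^sup>2 = (1 / (2 * Im z))\<^sup>2"
    using assms by simp
  moreover have "\<i> / of_real (2 * Im z) = \<i> * of_real (1 / (2 * Im z))" by simp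
  ultimately have "(Re w)\<^sup>2 + (Im w + 1 / (2 * Im z))\<^sup>2 = (1 / (2 * Im z))\<^sup>2"
    unfolding cmod_power2 by (simp del: of_real_divide of_real_mult)
  then have eq: "((Re w)\<^sup>2 + (Im w)\<^sup>2) * Im z = - Im w"
    using assms(1) by (simp add: power2_sum) (simp add: field_simps)
  have "(Re w)\<^sup>2 + (Im w)\<^sup>2 \<noteq> 0"
    using assms(2) by (simp add: complex_eq_iff sum_power2_eq_zero_iff)
  then have "Im (1 / w) = Im z"
    using eq by (simp add: Im_divide field_simps)
  then have "z - of_real (Re (z - 1 / w)) = 1 / w"
    by (simp add: complex_eq_iff)
  then show ?thesis
    using assms(2) by (intro exI[of _ "Re (z - 1 / w)"]) simp
qed

lemma SUP_cmod_real_shift_quotient: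
  assumes "0 < Im z1" "0 < Im z2"
  defines "S \<equiv> (cmod (z2 - cnj z1) + cmod (z2 - z1)) / (2 * Im z1)"
  shows "bdd_above (range (\<lambda>x::real. cmod ((z2 - of_real x) / (z1 - of_real x))))" (is "?B")
    and "(SUP x::real. cmod ((z2 - of_real x) / (z1 - of_real x))) = S" (is "?E")
proof -
  define f where "f x = cmod ((z2 - of_real x) / (z1 - of_real x))" for x :: real
  define d where "d = z2 - z1"
  define c where "c = - \<i> / of_real (2 * Im z1)"
  define r where "r = 1 / (2 * Im z1)"
  have f: "f x = cmod ((1 + d * c) + d * (1 / (z1 - of_real x) - c))" for x
  proof -
    have "z1 - of_real x \<noteq> 0" using assms by (auto simp: complex_eq_iff)
    then have "(z2 - of_real x) / (z1 - of_real x) = (1 + d * c) + d * (1 / (z1 - of_real x) - c)"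
      by (simp add: d_def field_simps)
    then show ?thesis by (simp add: f_def)
  qed
  have circ: "cmod (1 / (z1 - of_real x) - c) = r" for x
    using cmod_inverse_real_shift[OF assms(1), of x] by (simp add: c_def r_def)
  have S: "S = cmod (1 + d * c) + cmod d * r"
  proof -
    have "z1 - cnj z1 = \<i> * of_real (2 * Im z1)" by (simp add: complex_eq_iff)
    then have "z2 - cnj z1 = d + \<i> * of_real (2 * Im z1)" by (simp add: d_def algebra_simps)
    then have "1 + d * c = - \<i> * (z2 - cnj z1) / of_real (2 * Im z1)"
      using assms by (simp add: c_def field_simps)
    then have "cmod (1 + d * c) = cmod (z2 - cnj z1) / (2 * Im z1)"
      using assms(1) by (simp add: norm_mult norm_divide)
    then show ?thesis by (simp add: S_def r_def d_def add_divide_distrib)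
  qed
  have le: "f x \<le> S" for x
    unfolding f S using norm_triangle_ineq[of "1 + d * c" "d * (1 / (z1 - of_real x) - c)"]
    by (simp add: norm_mult circ)
  then have bdd: "bdd_above (range f)" by (auto intro: bdd_aboveI[where M = S])
  \<comment> \<open>\<open>c + r * u\<close> is a point of the circle of reciprocals at which the
    modulus bound \<open>S\<close> is attained. It equals some \<open>1 / (z1 - x)\<close> unless it
    is 0, hence the case split below.\<close>
  obtain u where u: "cmod u = 1" "cmod ((1 + d * c) + d * of_real r * u) = cmod (1 + d * c) + cmod (d * of_real r)"
    using exists_aligning_unit by blast
  have rpos: "r > 0" using assms by (simp add: r_def)
  have ge: "S \<le> (SUP x. f x)"
  proof (cases "c + of_real r * u = 0")
    case False
    have "cmod ((c + of_real r * u) + \<i> / of_real (2 * Im z1)) = 1 / (2 * Im z1)"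
      using u rpos by (simp add: c_def norm_mult) (simp add: r_def)
    from inverse_real_shift_surj[OF assms(1) False this] obtain x :: real
      where x: "c + of_real r * u = 1 / (z1 - of_real x)" by blast
    have "f x = S"
      unfolding f S x[symmetric] using u rpos by (simp add: norm_mult algebra_simps)
    then show ?thesis using cSUP_upper[OF _ bdd, of x] by simp
  next
    \<comment> \<open>The maximum over the full circle lies at the removed point 0, the limit for \<open>x \<rightarrow> \<infinity>\<close>.\<close>
    case True
    have "(1 + d * c) + d * of_real r * u = 1 + d * (c + of_real r * u)" by (simp add: algebra_simps)
    also have "\<dots> = 1" using True by simp
    finally have one: "(1 + d * c) + d * of_real r * u = 1" .
    have "S = 1" using u(2) rpos unfolding one by (simp add: S norm_mult)
    have "filterlim (\<lambda>x::real. - z1 + of_real x) at_infinity at_top"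
      by (intro tendsto_add_filterlim_at_infinity[OF tendsto_const] filterlim_of_real_at_infinity)
    then have "filterlim (\<lambda>x::real. of_real x - z1) at_infinity at_top"
      by simp
    then have "((\<lambda>x::real. d / (of_real x - z1)) \<longlongrightarrow> 0) at_top"
      by (intro tendsto_divide_0[OF tendsto_const])
    then have "((\<lambda>x::real. cmod (1 - d / (of_real x - z1))) \<longlongrightarrow> cmod (1 - 0)) at_top"
      by (intro tendsto_intros)
    moreover have "cmod (1 - d / (of_real x - z1)) = f x" for x :: real
      unfolding f by (simp add: algebra_simps) (metis minus_diff_eq divide_minus_right diff_minus_eq_add add.commute)
    ultimately have "(f \<longlongrightarrow> 1) at_top" by simp
    then have "1 \<le> (SUP x. f x)"
      by (rule tendsto_upperbound) (auto intro!: always_eventually cSUP_upper bdd)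
    then show ?thesis using \<open>S = 1\<close> by simp
  qed
  show ?B using bdd by (simp add: f_def[abs_def])
  have "(SUP x. f x) \<le> S" using le by (intro cSUP_least) auto
  with ge show ?E by (simp add: f_def[abs_def])
qed

lemma weak_metric_eq:
  assumes "0 < Im z1" "0 < Im z2"
  shows "weak_metric p z1 z2 = p / 2 * (ln (Im z1) - ln (Im z2))
           + ln (cmod (z2 - cnj z1) + cmod (z2 - z1)) - ln (2 * Im z1)"
proof -
  define k where "k = (Im z1) powr (p / 2) / (Im z2) powr (p / 2)"
  define g where "g x = cmod ((z2 - of_real x) / (z1 - of_real x))" for x :: real
  note sup = SUP_cmod_real_shift_quotient[OF assms, folded g_def]
  have kpos: "k > 0" using assms by (simp add: k_def)
  \<comment> \<open>Multiplication by \<open>k > 0\<close> is monotone and continuous, so it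
    commutes with the supremum of a nonempty set that is bounded above.\<close>
  have "k * (SUP x. g x) = (SUP s\<in>range g. k * s)"
    by (rule continuous_at_Sup_mono) (use sup(1) kpos in \<open>auto intro!: monoI continuous_intros\<close>)
  then have "(SUP x. k * g x) = k * (SUP x. g x)"
    by (simp add: image_image)
  then have "weak_metric p z1 z2 = ln (k * ((cmod (z2 - cnj z1) + cmod (z2 - z1)) / (2 * Im z1)))"
    by (simp add: weak_metric_def k_def[symmetric] g_def[symmetric] sup(2))
  moreover have "z2 - cnj z1 \<noteq> 0" using assms by (auto simp: complex_eq_iff)
  then have "cmod (z2 - cnj z1) + cmod (z2 - z1) > 0"
    by (simp add: add_pos_nonneg)
  moreover have "ln k = p / 2 * (ln (Im z1) - ln (Im z2))"
    using assms by (simp add: k_def ln_div ln_powr right_diff_distrib)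
  ultimately show ?thesis
    using assms kpos by (simp add: ln_mult_pos ln_div)
qed

text \<open>The weak norm is the derivative at 0 of the metric along the ray: the height ratio
  contributes \<open>- p * Im v / (2 * y)\<close>, the supremum
  \<open>(cmod v + Im v) / (2 * y)\<close>.\<close>

lemma weak_norm_eq:
  assumes "0 < Im z"
  shows "weak_norm p z v = (cmod v + (1 - p) * Im v) / (2 * Im z)"
proof -
  define y where "y = Im z"
  \<comment> \<open>Writing \<open>t * cmod v\<close> instead of \<open>cmod (t *\<^sub>R v)\<close>
    makes \<open>g\<close> differentiable at 0 from both sides; the two agree for
    \<open>t > 0\<close>.\<close>
  define g where "g t = p / 2 * (ln y - ln (y + t * Im v))
     + ln (sqrt ((t * Re v)\<^sup>2 + (2 * y + t * Im v)\<^sup>2) + t * cmod v) - ln (2 * y)" for t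
  have y: "y > 0" using assms by (simp add: y_def)
  have sqrt: "sqrt (4 * y\<^sup>2) = 2 * y" using y by (intro real_sqrt_unique) (auto simp: power_mult_distrib)
  have deriv: "(g has_real_derivative (cmod v + (1 - p) * Im v) / (2 * y)) (at 0)"
    unfolding g_def using y
    by (auto intro!: derivative_eq_intros simp: sqrt field_simps)
  have "g 0 = 0" using y by (simp add: g_def sqrt)
  with deriv have "((\<lambda>t. g t / t) \<longlongrightarrow> (cmod v + (1 - p) * Im v) / (2 * y)) (at_right 0)"
    by (auto simp: has_field_derivative_iff intro: tendsto_mono[OF at_le])
  moreover have "\<forall>\<^sub>F t in at_right 0. g t / t = weak_metric p z (z + t *\<^sub>R v) / t"
  proof -
    have "((\<lambda>t. y + t * Im v) \<longlongrightarrow> y + 0 * Im v) (at_right 0)"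
      by (intro tendsto_intros)
    then have "\<forall>\<^sub>F t in at_right 0. 0 < y + t * Im v"
      using y by (auto dest: order_tendstoD)
    moreover have "\<forall>\<^sub>F t::real in at_right 0. 0 < t"
      by (simp add: eventually_at_right_less)
    ultimately show ?thesis
    proof eventually_elim
      case (elim t)
      have "cmod (z + t *\<^sub>R v - cnj z) = sqrt ((t * Re v)\<^sup>2 + (2 * y + t * Im v)\<^sup>2)"
        by (simp add: cmod_def y_def algebra_simps)
      moreover have "cmod (z + t *\<^sub>R v - z) = t * cmod v"
        using elim by simp
      ultimately show ?case
        using weak_metric_eq[of z "z + t *\<^sub>R v" p] elim assms
        by (simp add: g_def y_def)
    qed
  qed
  ultimately have "((\<lambda>t. weak_metric p z (z + t *\<^sub>R v) / t) \<longlongrightarrow>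
      (cmod v + (1 - p) * Im v) / (2 * y)) (at_right 0)"
    by (rule Lim_transform_eventually)
  then show ?thesis
    unfolding weak_norm_def y_def by (intro tendsto_Lim) auto
qed

text \<open>On squaring, the terms \<open>(cmod v)\<^sup>2\<close> cancel and a factor
  \<open>c\<close> splits off. What remains is, for \<open>q > 0\<close>, the focus-directrix
  equation with eccentricity \<open>q\<close>.\<close>

lemma ellipse_focus_directrix:
  fixes v :: complex and q c :: real
  assumes "0 \<le> q" "q < 1" "0 < c"
  shows "cmod v + cmod (v + \<i> * of_real (q * c)) = c
     \<longleftrightarrow> 2 * (cmod v + q * Im v) = c * (1 - q\<^sup>2)"
proof -
  have sq: "(cmod (v + \<i> * of_real (q * c)))\<^sup>2 = (cmod v)\<^sup>2 + 2 * (q * c) * Im v + (q * c)\<^sup>2"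
    unfolding cmod_power2 by (simp add: power2_sum algebra_simps)
  have diff: "(c - cmod v)\<^sup>2 - (cmod (v + \<i> * of_real (q * c)))\<^sup>2
      = c * (c * (1 - q\<^sup>2) - 2 * (cmod v + q * Im v))"
    unfolding sq by (simp add: power2_eq_square algebra_simps)
  show ?thesis
  proof
    assume "cmod v + cmod (v + \<i> * of_real (q * c)) = c"
    then have "c - cmod v = cmod (v + \<i> * of_real (q * c))" by simp
    then show "2 * (cmod v + q * Im v) = c * (1 - q\<^sup>2)"
      using diff assms by simp
  next
    assume eq: "2 * (cmod v + q * Im v) = c * (1 - q\<^sup>2)"
    \<comment> \<open>Undoing the square requires \<open>cmod v \<le> c\<close>. Bounding
      \<open>Im v\<close> below in the linear equation gives
      \<open>2 * cmod v \<le> c * (1 + q)\<close>.\<close>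
    have "- cmod v \<le> Im v" using abs_Im_le_cmod[of v] by linarith
    then have "q * (- cmod v) \<le> q * Im v" using assms by (intro mult_left_mono) auto
    then have "(1 - q) * (2 * cmod v) \<le> (1 - q) * (c * (1 + q))"
      using eq by (simp add: power2_eq_square algebra_simps)
    then have "2 * cmod v \<le> c * (1 + q)" using assms by simp
    also have "\<dots> \<le> c * 2" using assms by (intro mult_left_mono) auto
    finally have "cmod v \<le> c" by simp
    moreover have "(c - cmod v)\<^sup>2 = (cmod (v + \<i> * of_real (q * c)))\<^sup>2"
      using diff eq by simp
    ultimately have "c - cmod v = cmod (v + \<i> * of_real (q * c))"
      by (simp add: power2_eq_iff_nonneg)
    then show "cmod v + cmod (v + \<i> * of_real (q * c)) = c" by simp
  qed
qed

theorem mainTheorem5: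
  fixes p :: real and \<zeta> :: complex
  assumes "0 < p" and "p \<le> 1" and "\<zeta> \<in> upper_half_plane"
  shows "ellipse_with_foci (unit_tangent_circle p \<zeta>)
           0 (- \<i> * complex_of_real (4 * Im \<zeta> * (1 - p) / (p * (2 - p))))"
proof -
  define q where "q = 1 - p"
  \<comment> \<open>\<open>c\<close> is the sum of the distances to the foci and
    \<open>q * c\<close> the distance between them; \<open>p = 1\<close> gives \<open>q = 0\<close>,
    a circle.\<close>
  define c where "c = 4 * Im \<zeta> / (p * (2 - p))"
  define f where "f = - \<i> * complex_of_real (4 * Im \<zeta> * (1 - p) / (p * (2 - p)))"
  have im: "0 < Im \<zeta>" using assms by (simp add: upper_half_plane_def)
  have q: "0 \<le> q" "q < 1" using assms by (auto simp: q_def)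
  have c: "0 < c" using assms im by (simp add: c_def)
  have f: "f = - (\<i> * of_real (q * c))"
    by (simp add: f_def q_def c_def)
  have "1 - q\<^sup>2 = p * (2 - p)" by (simp add: q_def power2_eq_square algebra_simps)
  then have cq: "c * (1 - q\<^sup>2) = 4 * Im \<zeta>" using assms by (simp add: c_def)
  have "v \<in> unit_tangent_circle p \<zeta> \<longleftrightarrow> dist v 0 + dist v f = c" for v
  proof -
    have "v \<in> unit_tangent_circle p \<zeta> \<longleftrightarrow> 2 * (cmod v + q * Im v) = 4 * Im \<zeta>"
      using im by (simp add: unit_tangent_circle_def weak_norm_eq divide_eq_eq flip: q_def) auto
    also have "\<dots> \<longleftrightarrow> cmod v + cmod (v + \<i> * of_real (q * c)) = c"
      unfolding ellipse_focus_directrix[OF q c] cq ..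
    finally show ?thesis by (simp add: f dist_norm)
  qed
  \<comment> \<open>The ellipse is nondegenerate because \<open>q < 1\<close>, which comes from
    \<open>0 < p\<close>.\<close>
  moreover have "dist 0 f < c"
    using q c by (simp add: f norm_mult abs_mult)
  ultimately show ?thesis
    unfolding ellipse_with_foci_def f_def[symmetric] by blast
qed

end
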